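(* Let $(P_n)_{n\ge0}$ be a family of monic classical orthogonal polynomials (Jacobi, Laguerre, Hermite or Bessel), so that for each $n$ $$\sigma(x)P_n''+\tau(x)P_n'+\lambda_nP_n=0,\qquad \lambda_n=-\frac n2(n-1)\sigma''-n\tau',$$ where $\sigma$ is a polynomial of degree at most $2$ and $\tau$ a polynomial of degree $1$. Let $r\ge1$ be an integer and let $P_n^{(-r)}$ be the monic anti-associated polynomials of order $r$ constructed from $(P_n)$ with new parameters $b_{-r},\dots,b_{-1}$ and $a_{-r+1}^2,\dots,a_{-1}^2,a_0^2\ne0$. Then, with the second order differential operator $R_2$ and the polynomials $M_0,N_0,M_1,N_1,M_2,N_2$ (depending on $n$) defined in the context, for every $n\ge0$ the polynomial $y=P_{n+r}^{(-r)}$ satisfies the fourth order linear differential equation $$\det\begin{pmatrix} R_2y & M_0 & N_0\\ \sigma\,[R_2y]' & M_1 & N_1\\ \sigma\,\bigl[\sigma\,[R_2y]'\bigr]' & M_2 & N_2\end{pmatrix}=0 .$$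
   Context: Let $b_n$ ($n\ge0$), $a_n^2\ne0$ ($n\ge1$) be the recurrence coefficients of the classical family: $P_{n+1}(x)=(x-b_n)P_n(x)-a_n^2P_{n-1}(x)$, $n\ge0$, $P_{-1}=0$, $P_0=1$. The monic anti-associated polynomials of order $r$ are defined by $$P_{n+1}^{(-r)}(x)=(x-b_{n-r})P_n^{(-r)}(x)-a_{n-r}^2P_{n-1}^{(-r)}(x),\quad n\ge0,\qquad P_0^{(-r)}=1,\ P_{-1}^{(-r)}=0$$ (the value of $a_{-r}^2$ is irrelevant). The polynomials $Q_n$ are defined by $Q_0=1$, $Q_{-1}=0$, $Q_{n+1}(x)=(x-b_{-r+n})Q_n(x)-a_{-r+n}^2Q_{n-1}(x)$ for $0\le n\le r-1$. Put $B(x)=-a_0^2Q_{r-1}(x)$ and $D=\frac{d}{dx}$. The operator $R_2$ is $$R_2=\sigma B^2D^2+\bigl[(2\sigma'-\tau)B^2-2\sigma BB'\bigr]D+2\sigma(B')^2-\sigma BB''-BB'(2\sigma'-\tau)-\Bigl[\frac{\sigma''}{2}(n^2-n-2)+\tau'(1+n)\Bigr]B^2 .$$ Write $R_2=\sigma B^2D^2+\rho_1D+\rho_0$ with $\rho_1,\rho_0$ the polynomial coefficients above. The polynomials $M_i,N_i$ are the coefficients of $P_n$ and $P_n'$ obtained as follows, where second derivatives $P_n''$ are always eliminated via $\sigma P_n''=-\tau P_n'-\lambda_nP_n$. First, $M_0P_n+N_0P_n'$ is the expression $R_2[Q_rP_n]+(\sigma''-2\tau')B^3P_n'$ after this elimination,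 i.e. $$M_0=\sigma B^2Q_r''+\rho_1Q_r'+(\rho_0-\lambda_nB^2)Q_r,\qquad N_0=2\sigma B^2Q_r'+(\rho_1-\tau B^2)Q_r+(\sigma''-2\tau')B^3 .$$ Then, for $i=0,1$, $M_{i+1}P_n+N_{i+1}P_n'$ is the expression $\sigma\,(M_iP_n+N_iP_n')'$ after this elimination, i.e. $$M_{i+1}=\sigma M_i'-\lambda_nN_i,\qquad N_{i+1}=\sigma N_i'+\sigma M_i-\tau N_i .$$ *)

theory Defs
  imports "HOL-Analysis.Determinants" "HOL-Computational_Algebra.Polynomial"
begin

text \<open>
  Monic polynomials \<open>p\<^sub>n\<close> with \<open>p\<^sub>n\<^sub>+\<^sub>1 = (x - \<beta>\<^sub>n) p\<^sub>n - \<gamma>\<^sub>n p\<^sub>n\<^sub>-\<^sub>1\<close> for \<open>n \<ge> 0\<close>,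
  \<open>p\<^sub>0 = 1\<close> and \<open>p\<^sub>-\<^sub>1 = 0\<close>; the step \<open>n = 0\<close> reads \<open>p\<^sub>1 = x - \<beta>\<^sub>0\<close>, so \<open>\<gamma>\<^sub>0\<close> is irrelevant.
\<close>

fun recurrence_poly :: "(nat \<Rightarrow> complex) \<Rightarrow> (nat \<Rightarrow> complex) \<Rightarrow> nat \<Rightarrow> complex poly" where
  "recurrence_poly \<beta> \<gamma> 0 = 1"
| "recurrence_poly \<beta> \<gamma> (Suc 0) = [:- \<beta> 0, 1:]"
| "recurrence_poly \<beta> \<gamma> (Suc (Suc n)) =
     [:- \<beta> (Suc n), 1:] * recurrence_poly \<beta> \<gamma> (Suc n)
     - smult (\<gamma> (Suc n)) (recurrence_poly \<beta> \<gamma> n)"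

text \<open>
  Orthogonality is with respect to a quasi-definite linear functional on polynomials,
  not necessarily a positive measure (as needed, e.g., for the Bessel polynomials).
\<close>

definition monic_OPS :: "(nat \<Rightarrow> complex poly) \<Rightarrow> bool" where
  "monic_OPS P \<longleftrightarrow>
     (\<forall>n. degree (P n) = n \<and> lead_coeff (P n) = 1) \<and>
     (\<exists>U :: complex poly \<Rightarrow> complex.
        (\<forall>p q. U (p + q) = U p + U q) \<and> (\<forall>c p. U (smult c p) = c * U p) \<and>
        (\<forall>m n. U (P m * P n) = 0 \<longleftrightarrow> m \<noteq> n))"

definition eigenval :: "complex poly \<Rightarrow> complex poly \<Rightarrow> nat \<Rightarrow> complex poly" where
  "eigenval \<sigma> \<tau> n =
     - smult (of_nat n / 2 * (of_nat n - 1)) (pderiv (pderiv \<sigma>)) - smult (of_nat n) (pderiv \<tau>)"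

text \<open>
  By Bochner's theorem these are, up to a complex affine change of variable, exactly the
  Jacobi, Laguerre, Hermite and Bessel families.
\<close>

definition classical_OPS ::
  "complex poly \<Rightarrow> complex poly \<Rightarrow> (nat \<Rightarrow> complex poly) \<Rightarrow> bool" where
  "classical_OPS \<sigma> \<tau> P \<longleftrightarrow>
     monic_OPS P \<and> degree \<sigma> \<le> 2 \<and> degree \<tau> = 1 \<and>
     (\<forall>n. \<sigma> * pderiv (pderiv (P n)) + \<tau> * pderiv (P n) + eigenval \<sigma> \<tau> n * P n = 0)"

text \<open>
  The parameter sequences are indexed by the integers: the nonnegative (for \<open>b\<close>) and positive
  (for \<open>a\<close>) indices belong to \<open>P\<close>, the others are the new parameters.
\<close>

definition recurrence_coeffs ::
  "(int \<Rightarrow> complex) \<Rightarrow> (int \<Rightarrow> complex) \<Rightarrow> (nat \<Rightarrow> complex poly) \<Rightarrow> bool" where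
  "recurrence_coeffs b a P \<longleftrightarrow>
     (\<forall>n\<ge>1. (a n)\<^sup>2 \<noteq> 0) \<and>
     P = recurrence_poly (\<lambda>n. b (int n)) (\<lambda>n. (a (int n))\<^sup>2)"

definition anti_associated ::
  "(int \<Rightarrow> complex) \<Rightarrow> (int \<Rightarrow> complex) \<Rightarrow> nat \<Rightarrow> nat \<Rightarrow> complex poly" where
  "anti_associated b a r =
     recurrence_poly (\<lambda>n. b (int n - int r)) (\<lambda>n. (a (int n - int r))\<^sup>2)"

text \<open>Only the indices \<open>n \<le> r\<close> of \<open>Q_poly b a r n\<close> are meaningful.\<close>

definition Q_poly ::
  "(int \<Rightarrow> complex) \<Rightarrow> (int \<Rightarrow> complex) \<Rightarrow> nat \<Rightarrow> nat \<Rightarrow> complex poly" where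
  "Q_poly b a r =
     recurrence_poly (\<lambda>n. b (- int r + int n)) (\<lambda>n. (a (- int r + int n))\<^sup>2)"

definition B_poly :: "(int \<Rightarrow> complex) \<Rightarrow> (int \<Rightarrow> complex) \<Rightarrow> nat \<Rightarrow> complex poly" where
  "B_poly b a r = - smult ((a 0)\<^sup>2) (Q_poly b a r (r - 1))"

definition \<rho>\<^sub>1 :: "complex poly \<Rightarrow> complex poly \<Rightarrow> complex poly \<Rightarrow> complex poly" where
  "\<rho>\<^sub>1 \<sigma> \<tau> B = (2 * pderiv \<sigma> - \<tau>) * B\<^sup>2 - 2 * \<sigma> * B * pderiv B"

definition \<rho>\<^sub>0 :: "complex poly \<Rightarrow> complex poly \<Rightarrow> complex poly \<Rightarrow> nat \<Rightarrow> complex poly" where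
  "\<rho>\<^sub>0 \<sigma> \<tau> B n =
     2 * \<sigma> * (pderiv B)\<^sup>2 - \<sigma> * B * pderiv (pderiv B) - B * pderiv B * (2 * pderiv \<sigma> - \<tau>)
     - (smult (((of_nat n)\<^sup>2 - of_nat n - 2) / 2) (pderiv (pderiv \<sigma>))
        + smult (1 + of_nat n) (pderiv \<tau>)) * B\<^sup>2"

definition R\<^sub>2 ::
  "complex poly \<Rightarrow> complex poly \<Rightarrow> complex poly \<Rightarrow> nat \<Rightarrow> complex poly \<Rightarrow> complex poly" where
  "R\<^sub>2 \<sigma> \<tau> B n y =
     \<sigma> * B\<^sup>2 * pderiv (pderiv y) + \<rho>\<^sub>1 \<sigma> \<tau> B * pderiv y + \<rho>\<^sub>0 \<sigma> \<tau> B n * y"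

text \<open>
  Coefficients of \<open>P\<^sub>n\<close> and \<open>P\<^sub>n'\<close> in \<open>R\<^sub>2[Q P\<^sub>n] + (\<sigma>'' - 2\<tau>') B\<^sup>3 P\<^sub>n'\<close> (index \<open>0\<close>) and in its
  successive images under \<open>f \<mapsto> \<sigma> f'\<close>, after eliminating \<open>P\<^sub>n''\<close> by means of
  \<open>\<sigma> P\<^sub>n'' = - \<tau> P\<^sub>n' - \<lambda>\<^sub>n P\<^sub>n\<close>.
\<close>

fun M_poly N_poly ::
  "complex poly \<Rightarrow> complex poly \<Rightarrow> complex poly \<Rightarrow> complex poly \<Rightarrow> nat \<Rightarrow> nat \<Rightarrow> complex poly"
where
  "M_poly \<sigma> \<tau> B Q n 0 =
     \<sigma> * B\<^sup>2 * pderiv (pderiv Q) + \<rho>\<^sub>1 \<sigma> \<tau> B * pderiv Q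
     + (\<rho>\<^sub>0 \<sigma> \<tau> B n - eigenval \<sigma> \<tau> n * B\<^sup>2) * Q"
| "M_poly \<sigma> \<tau> B Q n (Suc i) =
     \<sigma> * pderiv (M_poly \<sigma> \<tau> B Q n i) - eigenval \<sigma> \<tau> n * N_poly \<sigma> \<tau> B Q n i"
| "N_poly \<sigma> \<tau> B Q n 0 =
     2 * \<sigma> * B\<^sup>2 * pderiv Q + (\<rho>\<^sub>1 \<sigma> \<tau> B - \<tau> * B\<^sup>2) * Q
     + (pderiv (pderiv \<sigma>) - 2 * pderiv \<tau>) * B ^ 3"
| "N_poly \<sigma> \<tau> B Q n (Suc i) =
     \<sigma> * pderiv (N_poly \<sigma> \<tau> B Q n i) + \<sigma> * M_poly \<sigma> \<tau> B Q n i - \<tau> * N_poly \<sigma> \<tau> B Q n i"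

end

theory Submission imports Defs begin

text \<open>
  Let \<open>U\<close> be the orthogonality functional and \<open>u = \<langle>U, 1\<rangle> \<noteq> 0\<close>. Two families of solutions of the
  three-term recurrence of \<open>P\<close> are available: \<open>P\<close> itself and the polynomials
  \<open>(\<theta>P\<^sub>n)(x) = U\<^sub>t ((P\<^sub>n(x) - P\<^sub>n(t)) / (x - t))\<close>, which are \<open>u\<close> times the first associated polynomials.
  From index \<open>r\<close> on, the anti-associated polynomials satisfy that same recurrence, so they are a
  combination with coefficients fixed by two initial values:
  \<open>u P\<^sub>n\<^sub>+\<^sub>r\<^sup>(\<^sup>-\<^sup>r\<^sup>) = u Q\<^sub>r P\<^sub>n + B \<theta>P\<^sub>n\<close> (lemma \<open>anti_associated_decomposition\<close>).

  Put \<open>A = \<sigma>D\<^sup>2 + \<tau>D\<close>, with formal adjoint \<open>A\<^sup>* = D\<^sup>2\<sigma> - D\<tau>\<close>. The differential equation of \<open>P\<close> forces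
  the Pearson equation \<open>U(\<sigma>q' + \<tau>q) = 0\<close> (lemma \<open>classical_functional_Pearson\<close>), and this
  gives the intertwining relation \<open>A\<^sup>*\<theta>p = \<theta>Ap + u(\<sigma>'' - 2\<tau>')p'\<close> for all polynomials \<open>p\<close>
  (lemma \<open>theta_intertwines_adjoint\<close>). At \<open>p = P\<^sub>n\<close> it says that \<open>A\<^sup>* + \<lambda>\<^sub>n\<close> maps \<open>\<theta>P\<^sub>n\<close> to a multiple
  of \<open>P\<^sub>n'\<close>.

  The operator \<open>R\<^sub>2\<close> is \<open>B\<^sup>3 (A\<^sup>* + \<lambda>\<^sub>n) B\<^sup>-\<^sup>1\<close>. It therefore turns the summand \<open>B \<theta>P\<^sub>n\<close> into
  \<open>u (\<sigma>'' - 2\<tau>') B\<^sup>3 P\<^sub>n'\<close>, whence \<open>R\<^sub>2y = M\<^sub>0P\<^sub>n + N\<^sub>0P\<^sub>n'\<close>. Applying \<open>\<sigma>D\<close> twice expresses the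
  whole first column of the determinant by the other two, with the coefficients \<open>P\<^sub>n\<close> and \<open>P\<^sub>n'\<close>.
\<close>

section \<open>The divided-difference transform of a linear functional\<close>

definition linear_functional :: "('a::comm_ring_1 poly \<Rightarrow> 'a) \<Rightarrow> bool" where
  "linear_functional U \<longleftrightarrow>
     (\<forall>p q. U (p + q) = U p + U q) \<and> (\<forall>c p. U (smult c p) = c * U p)"

lemma linear_functional_simps:
  assumes "linear_functional U"
  shows "U (p + q) = U p + U q" "U (smult c p) = c * U p" "U 0 = 0"
    "U (p - q) = U p - U q" "U (- p) = - U p"
proof -
  show add: "U (p + q) = U p + U q" and smult: "U (smult c p) = c * U p" for p q c
    using assms by (auto simp: linear_functional_def)
  show "U 0 = 0" using smult[of 0 0] by simp
  show minus: "U (- p) = - U p" for p using smult[of "-1" p] by simp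
  show "U (p - q) = U p - U q" using add[of p "- q"] minus[of q] by simp
qed

text \<open>
  This is \<open>(\<theta>p)(x) = U\<^sub>t ((p(x) - p(t)) / (x - t))\<close>: since
  \<open>(x\<^sup>k - t\<^sup>k) / (x - t) = \<Sum>\<^sub>j\<^sub><\<^sub>k x\<^sup>j t\<^sup>k\<^sup>-\<^sup>1\<^sup>-\<^sup>j\<close>, the coefficient of \<open>x\<^sup>j\<close> in the divided difference
  is \<open>p(t)\<close> shifted down by \<open>j + 1\<close> places. The coefficientwise form avoids bivariate polynomials.
\<close>

definition theta :: "('a::comm_ring_1 poly \<Rightarrow> 'a) \<Rightarrow> 'a poly \<Rightarrow> 'a poly" where
  "theta U p = (\<Sum>j<degree p. monom (U (poly_shift (Suc j) p)) j)"

lemma coeff_theta: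
  assumes "linear_functional U"
  shows "coeff (theta U p) j = U (poly_shift (Suc j) p)"
proof -
  have "poly_shift (Suc j) p = 0" if "degree p \<le> j"
    using that by (intro poly_eqI) (simp add: coeff_poly_shift coeff_eq_0)
  then show ?thesis
    using linear_functional_simps(3)[OF assms]
    by (auto simp: theta_def coeff_sum if_distrib not_less cong: if_cong)
qed

lemma theta_linear:
  assumes "linear_functional U"
  shows "theta U (p + q) = theta U p + theta U q" "theta U (smult c p) = smult c (theta U p)"
    "theta U (p - q) = theta U p - theta U q" "theta U (- p) = - theta U p"
proof -
  have shift: "poly_shift k (p + q) = poly_shift k p + poly_shift k q"
    "poly_shift k (smult c p) = smult c (poly_shift k p)" for k c and p q :: "'a poly"
    by (simp_all add: poly_eq_iff coeff_poly_shift)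
  show add: "theta U (p + q) = theta U p + theta U q"
    and smult: "theta U (smult c p) = smult c (theta U p)" for p q c
    by (simp_all add: poly_eq_iff coeff_theta[OF assms] shift linear_functional_simps[OF assms])
  show minus: "theta U (- p) = - theta U p" for p using smult[of "-1" p] by simp
  show "theta U (p - q) = theta U p - theta U q" using add[of p "- q"] minus[of q] by simp
qed

text \<open>
  Multiplying \<open>p\<close> by the variable adds \<open>t (p(x) - p(t)) / (x - t) + p(x)\<close>, that is
  \<open>x (p(x) - p(t)) / (x - t) + p(t)\<close>; constants have divided difference \<open>0\<close>. With linearity,
  this commutation rule determines \<open>\<theta>\<close>, and the later identities are inductions based on it.
\<close>

lemma theta_pCons:
  assumes "linear_functional U"
  shows "theta U (pCons c p) = pCons (U p) (theta U p)"
proof (rule poly_eqI)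
  fix j
  have "poly_shift (Suc k) (pCons c p) = poly_shift k p" for k
    by (simp add: poly_eq_iff coeff_poly_shift)
  moreover have "poly_shift 0 p = p"
    by (simp add: poly_eq_iff coeff_poly_shift)
  ultimately show "coeff (theta U (pCons c p)) j = coeff (pCons (U p) (theta U p)) j"
    by (cases j) (simp_all add: coeff_theta[OF assms])
qed

lemma theta_0 [simp]: "theta U 0 = 0"
  by (simp add: theta_def)

lemma theta_1 [simp]: "theta U 1 = 0"
  by (simp add: theta_def)

section \<open>The intertwining relation\<close>

text \<open>
  Commuting the intertwining relation below with multiplication by the variable leaves this
  first-order relation. Commuting once more leaves only \<open>U(\<sigma>p' + \<tau>p) = 0\<close>.
\<close>

lemma theta_first_order:
  fixes U :: "'a::idom poly \<Rightarrow> 'a"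
  assumes U: "linear_functional U" and "degree \<sigma> \<le> 2" and "degree \<tau> \<le> 1"
    and Pearson: "\<And>q. U (\<sigma> * pderiv q + \<tau> * q) = 0"
  shows "theta U (2 * \<sigma> * pderiv p + \<tau> * p) =
    2 * \<sigma> * pderiv (theta U p) + (2 * pderiv \<sigma> - \<tau>) * theta U p
    + (pderiv (pderiv \<sigma>) - pderiv \<tau>) * [:U p:]
    - (pderiv (pderiv \<sigma>) - 2 * pderiv \<tau>) * [:U 1:] * p"
proof -
  define X :: "'a poly" where "X = [:0, 1:]"
  have pC: "pCons c f = [:c:] + X * f" for c f by (simp add: X_def)
  define S0 S1 S2 T0 T1 where "S0 = [:coeff \<sigma> 0:]" and "S1 = [:coeff \<sigma> 1:]"
    and "S2 = [:coeff \<sigma> 2:]" and "T0 = [:coeff \<tau> 0:]" and "T1 = [:coeff \<tau> 1:]"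
  note S_defs = S0_def S1_def S2_def T0_def T1_def
  have const: "[:c:] * f = smult c f" for c and f :: "'a poly" by simp
  have \<sigma>: "\<sigma> = S0 + X * S1 + X * (X * S2)"
  proof (rule poly_eqI)
    fix k :: nat
    consider "k = 0" | "k = 1" | "k = 2" | "k > 2" by linarith
    then show "coeff \<sigma> k = coeff (S0 + X * S1 + X * (X * S2)) k"
      using assms(2)
      by cases (auto simp: S_defs X_def coeff_eq_0 coeff_pCons numeral_2_eq_2 split: nat.splits)
  qed
  have \<tau>: "\<tau> = T0 + X * T1"
  proof (rule poly_eqI)
    fix k :: nat
    consider "k = 0" | "k = 1" | "k > 1" by linarith
    then show "coeff \<tau> k = coeff (T0 + X * T1) k"
      using assms(3) by cases (auto simp: S_defs X_def coeff_eq_0 coeff_pCons split: nat.splits)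
  qed
  have dX: "pderiv (X * f) = f + X * pderiv f" "pderiv X = 1" for f
    by (simp_all add: X_def pderiv_pCons)
  have dS: "pderiv S0 = 0" "pderiv S1 = 0" "pderiv S2 = 0" "pderiv T0 = 0" "pderiv T1 = 0"
    by (simp_all add: S_defs pderiv_pCons)
  have d\<sigma>: "pderiv \<sigma> = S1 + 2 * X * S2" and dd\<sigma>: "pderiv (pderiv \<sigma>) = 2 * S2"
    and d\<tau>: "pderiv \<tau> = T1"
    by (simp_all add: \<sigma> \<tau> pderiv_add dX dS mult.assoc pderiv_mult)
  define V where "V f = [:U f:]" for f
  have V_const: "V (S0 * f) = S0 * V f" "V (S1 * f) = S1 * V f" "V (S2 * f) = S2 * V f"
     "V (T0 * f) = T0 * V f" "V (T1 * f) = T1 * V f" for f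
    by (simp_all add: V_def S_defs const linear_functional_simps[OF U])
  have V_add: "V (f + g) = V f + V g" for f g
    by (simp add: V_def linear_functional_simps[OF U])
  have \<theta>_X: "theta U (X * f) = X * theta U f + V f" for f
    by (simp add: X_def V_def theta_pCons[OF U])
  have \<theta>_const: "theta U (S0 * f) = S0 * theta U f" "theta U (S1 * f) = S1 * theta U f"
     "theta U (S2 * f) = S2 * theta U f" "theta U (T0 * f) = T0 * theta U f"
     "theta U (T1 * f) = T1 * theta U f" for f
    by (simp_all add: S_defs const theta_linear[OF U])
  have \<theta>_add: "theta U (f + g) = theta U f + theta U g" for f g
    by (rule theta_linear[OF U])
  \<comment> \<open>the defect of the identity: it commutes with multiplication by \<open>X\<close> and kills constants\<close>
  define G where "G p = 2 * \<sigma> * pderiv (theta U p) + (2 * pderiv \<sigma> - \<tau>) * theta U p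
    + (pderiv (pderiv \<sigma>) - pderiv \<tau>) * V p - (pderiv (pderiv \<sigma>) - 2 * pderiv \<tau>) * V 1 * p
    - theta U (2 * \<sigma> * pderiv p + \<tau> * p)" for p
  have G_add: "G (f + g) = G f + G g" for f g
    by (simp add: G_def \<theta>_add V_add pderiv_add algebra_simps)
  have G_X: "G (X * f) = X * G f" for f
  proof -
    have \<theta>\<sigma>: "theta U (\<sigma> * f) = \<sigma> * theta U f + S1 * V f + S2 * (X * V f + V (X * f))"
    proof -
      have "\<sigma> * f = S0 * f + (S1 * (X * f) + S2 * (X * (X * f)))"
        by (simp add: \<sigma> algebra_simps)
      then show ?thesis
        by (simp only: \<theta>_add \<theta>_const \<theta>_X) (simp add: \<sigma> algebra_simps)
    qed
    have V\<tau>: "V (\<tau> * f) = T0 * V f + T1 * V (X * f)"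
    proof -
      have "\<tau> * f = T0 * f + T1 * (X * f)" by (simp add: \<tau> algebra_simps)
      then show ?thesis by (simp only: V_add V_const)
    qed
    have "V (2 * \<sigma> * pderiv f + \<tau> * f) + V (\<tau> * f) =
        V (\<sigma> * pderiv f + \<tau> * f) + V (\<sigma> * pderiv f + \<tau> * f)"
      by (simp add: V_add[symmetric] algebra_simps)
    then have V0: "V (2 * \<sigma> * pderiv f + \<tau> * f) = - V (\<tau> * f)"
      using Pearson[of f] by (simp add: V_def add_eq_0_iff)
    have "2 * \<sigma> * pderiv (X * f) + \<tau> * (X * f) =
        X * (2 * \<sigma> * pderiv f + \<tau> * f) + (\<sigma> * f + \<sigma> * f)"
      by (simp add: dX algebra_simps)
    then have \<theta>X: "theta U (2 * \<sigma> * pderiv (X * f) + \<tau> * (X * f)) =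
        X * theta U (2 * \<sigma> * pderiv f + \<tau> * f) + V (2 * \<sigma> * pderiv f + \<tau> * f)
         + 2 * theta U (\<sigma> * f)"
      by (simp only: \<theta>_X \<theta>_add) simp
    have dV: "pderiv (V f) = 0" by (simp add: V_def pderiv_pCons)
    show ?thesis
      unfolding G_def \<theta>X V0 V\<tau> \<theta>\<sigma>
      unfolding \<theta>_X pderiv_add dX dV d\<tau> dd\<sigma>
      unfolding d\<sigma>
      by (simp add: \<tau> algebra_simps)
  qed
  have G_const: "G [:c:] = 0" for c
  proof -
    have \<theta>0: "theta U [:c:] = 0" by (simp add: theta_pCons[OF U] linear_functional_simps[OF U])
    have "\<tau> * [:c:] = T0 * [:c:] + X * (T1 * [:c:])" by (simp add: \<tau> algebra_simps)
    then have "theta U (\<tau> * [:c:]) = T1 * V [:c:]"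
      by (simp only: \<theta>_add \<theta>_const \<theta>_X V_const \<theta>0) simp
    moreover have "V [:c:] = V 1 * [:c:]"
      using linear_functional_simps(2)[OF U, of c 1] by (simp add: V_def mult.commute)
    ultimately show ?thesis
      by (simp add: G_def pderiv_pCons dd\<sigma> d\<tau> \<theta>0 algebra_simps)
  qed
  have "G p = 0"
  proof (induction p)
    case 0
    show ?case using G_const[of 0] by simp
  next
    case (pCons c p)
    then show ?case by (simp add: pC[of c p] G_add G_X G_const)
  qed
  then show ?thesis by (simp add: G_def V_def)
qed

text \<open>
  Both sides are linear in \<open>p\<close> and agree on constants, so it suffices that they transform alike
  under \<open>p \<mapsto> xp\<close>. Since \<open>[A, x] = 2\<sigma>D + \<tau>\<close> and \<open>[A\<^sup>*, x] = 2\<sigma>D + 2\<sigma>' - \<tau>\<close>, and \<open>U\<close> annihilates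
  the range of \<open>A\<close>, that is lemma \<open>theta_first_order\<close>.
\<close>

lemma theta_intertwines_adjoint:
  fixes U :: "'a::idom poly \<Rightarrow> 'a"
  assumes U: "linear_functional U" and "degree \<sigma> \<le> 2" and "degree \<tau> \<le> 1"
    and Pearson: "\<And>q. U (\<sigma> * pderiv q + \<tau> * q) = 0"
  shows "\<sigma> * pderiv (pderiv (theta U p)) + (2 * pderiv \<sigma> - \<tau>) * pderiv (theta U p)
      + (pderiv (pderiv \<sigma>) - pderiv \<tau>) * theta U p =
    theta U (\<sigma> * pderiv (pderiv p) + \<tau> * pderiv p)
      + (pderiv (pderiv \<sigma>) - 2 * pderiv \<tau>) * [:U 1:] * pderiv p"
proof (induction p)
  case 0
  show ?case by simp
next
  case (pCons c p)
  define X :: "'a poly" where "X = [:0, 1:]"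
  have dX: "pderiv (pCons c f) = f + X * pderiv f" "pderiv (X * f) = f + X * pderiv f" for c f
    by (simp_all add: X_def pderiv_pCons)
  have \<theta>_pCons: "theta U (pCons e f) = X * theta U f + [:U f:]"
    and \<theta>_X: "theta U (X * f) = X * theta U f + [:U f:]" for e f
    by (simp_all add: X_def theta_pCons[OF U])
  have "\<sigma> * pderiv (pderiv (pCons c p)) + \<tau> * pderiv (pCons c p) =
      X * (\<sigma> * pderiv (pderiv p) + \<tau> * pderiv p) + (2 * \<sigma> * pderiv p + \<tau> * p)"
    by (simp add: dX pderiv_add algebra_simps)
  then have "theta U (\<sigma> * pderiv (pderiv (pCons c p)) + \<tau> * pderiv (pCons c p)) =
      X * theta U (\<sigma> * pderiv (pderiv p) + \<tau> * pderiv p)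
      + theta U (2 * \<sigma> * pderiv p + \<tau> * p)"
    using Pearson[of "pderiv p"] by (simp only: theta_linear[OF U] \<theta>_X) simp
  also have "\<dots> = X * (\<sigma> * pderiv (pderiv (theta U p)) + (2 * pderiv \<sigma> - \<tau>) * pderiv (theta U p)
      + (pderiv (pderiv \<sigma>) - pderiv \<tau>) * theta U p
      - (pderiv (pderiv \<sigma>) - 2 * pderiv \<tau>) * [:U 1:] * pderiv p)
      + theta U (2 * \<sigma> * pderiv p + \<tau> * p)"
    using pCons.IH by simp
  finally show ?case
    unfolding theta_first_order[OF assms]
    unfolding \<theta>_pCons dX pderiv_add pderiv_singleton
    by (simp add: smult_add_right algebra_simps)
qed

section \<open>Classical functionals\<close>

lemma linear_functional_eq_0_if_monic_basis:
  fixes f :: "'a::comm_ring_1 poly \<Rightarrow> 'a"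
  assumes f: "linear_functional f" and "\<And>n. degree (P n) = n" "\<And>n. lead_coeff (P n) = 1"
    and 0: "\<And>n. f (P n) = 0"
  shows "f p = 0"
proof (induction "degree p" arbitrary: p rule: less_induct)
  case less
  define c where "c = lead_coeff p"
  define q where "q = p - smult c (P (degree p))"
  have fq: "f p = f q"
    by (simp add: q_def linear_functional_simps[OF f] 0)
  have "degree q \<le> degree p"
    unfolding q_def by (rule degree_diff_le) (use assms(2) degree_smult_le[of c "P (degree p)"] in auto)
  moreover have "coeff q (degree p) = 0"
    using assms(3)[of "degree p"] assms(2) by (simp add: q_def c_def)
  ultimately have "q = 0 \<or> degree q < degree p"
    by (metis le_neq_implies_less leading_coeff_0_iff)
  then show ?case using less fq linear_functional_simps(3)[OF f] by auto
qed

lemma eigenval_eq_const: "\<exists>l. eigenval \<sigma> \<tau> n = [:l:]" if "degree \<sigma> \<le> 2" "degree \<tau> = 1"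
proof -
  have "degree (eigenval \<sigma> \<tau> n) = 0"
    unfolding eigenval_def using that
    by (intro le_antisym degree_diff_le) (auto simp: degree_pderiv intro: degree_smult_le[THEN le_trans])
  then show ?thesis by (metis degree_eq_zeroE)
qed

text \<open>
  \<open>U\<close> annihilates \<open>AP\<^sub>n = -\<lambda>\<^sub>nP\<^sub>n\<close> for every \<open>n\<close> (for \<open>n = 0\<close> because \<open>A1 = 0\<close>), hence the range
  of \<open>A\<close>. Over a field of characteristic \<open>0\<close> every polynomial is a derivative, which turns
  \<open>U(\<sigma>p'' + \<tau>p') = 0\<close> into the Pearson equation.
\<close>

lemma classical_functional_Pearson:
  assumes "classical_OPS \<sigma> \<tau> P" and U: "linear_functional U"
    and orth: "\<And>n. n > 0 \<Longrightarrow> U (P n) = 0"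
  shows "U (\<sigma> * pderiv q + \<tau> * q) = 0"
proof -
  define f where "f p = U (\<sigma> * pderiv (pderiv p) + \<tau> * pderiv p)" for p
  have f: "linear_functional f"
    unfolding linear_functional_def f_def
    by (auto simp: pderiv_add pderiv_smult smult_add_right[symmetric] linear_functional_simps[OF U] algebra_simps)
  have monic: "degree (P n) = n" "lead_coeff (P n) = 1" for n
    using assms(1) unfolding classical_OPS_def monic_OPS_def by blast+
  have ode: "\<sigma> * pderiv (pderiv (P n)) + \<tau> * pderiv (P n) = - (eigenval \<sigma> \<tau> n * P n)" for n
    using assms(1) by (simp add: classical_OPS_def eq_neg_iff_add_eq_0)
  have "f (P n) = 0" for n
  proof -
    obtain l where "eigenval \<sigma> \<tau> n = [:l:]"
      using eigenval_eq_const[of \<sigma> \<tau> n] assms(1) by (auto simp: classical_OPS_def)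
    moreover have "l = 0 \<or> n > 0"
      using calculation by (cases n) (auto simp: eigenval_def)
    ultimately show ?thesis
      using orth[of n] by (auto simp: f_def ode linear_functional_simps[OF U])
  qed
  then have f0: "f p = 0" for p
    using linear_functional_eq_0_if_monic_basis[OF f] monic by blast
  define p where "p = Poly (0 # map (\<lambda>k. coeff q k / of_nat (Suc k)) [0..<Suc (degree q)])"
  have "pderiv p = q"
  proof (rule poly_eqI)
    fix k
    show "coeff (pderiv p) k = coeff q k"
      by (cases "k \<le> degree q")
        (auto simp: p_def coeff_pderiv nth_default_def coeff_eq_0 simp del: of_nat_Suc upt_Suc)
  qed
  then show ?thesis using f0[of p] by (simp add: f_def)
qed

section \<open>Anti-associated polynomials\<close>

text \<open>
  As functions of \<open>n\<close>, all three terms solve the recurrence with coefficients \<open>b\<^sub>n\<close>, \<open>a\<^sub>n\<^sup>2\<close> for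
  \<open>n \<ge> 1\<close>; for \<open>\<theta>P\<^sub>n\<close> the inhomogeneity is \<open>U(P\<^sub>n) = 0\<close>. It remains to compare \<open>n = 0\<close> and \<open>n = 1\<close>.
\<close>

lemma anti_associated_decomposition:
  assumes rec: "recurrence_coeffs b a P" and U: "linear_functional U"
    and orth: "\<And>n. n > 0 \<Longrightarrow> U (P n) = 0" and "r \<ge> 1"
  shows "smult (U 1) (anti_associated b a r (n + r)) =
    smult (U 1) (Q_poly b a r r * P n) + B_poly b a r * theta U (P n)"
proof -
  have P0: "P 0 = 1" and P1: "P (Suc 0) = [:- b 0, 1:]"
    and P_step: "P (n + 2) = [:- b (int n + 1), 1:] * P (n + 1) - smult ((a (int n + 1))\<^sup>2) (P n)" for n
    using rec by (auto simp: recurrence_coeffs_def add.commute)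
  have AQ: "anti_associated b a r = Q_poly b a r"
    by (simp add: anti_associated_def Q_poly_def)
  obtain k where r: "r = Suc k" using \<open>r \<ge> 1\<close> by (cases r) auto
  have y_step: "anti_associated b a r (n + 1 + r) =
      [:- b (int n), 1:] * anti_associated b a r (n + r)
      - smult ((a (int n))\<^sup>2) (anti_associated b a r (n + r - 1))" for n
    by (simp add: anti_associated_def r)
  have \<theta>_mult: "theta U ([:c, 1:] * p) = [:c, 1:] * theta U p + [:U p:]" for c p
    by (simp add: theta_linear[OF U] theta_pCons[OF U])
  have "theta U (P 1) = [:U 1:]"
    using \<theta>_mult[of "- b 0" 1] by (simp add: P1)
  define y where "y n = anti_associated b a r (n + r)" for n
  have "smult (U 1) (y n) =
    smult (U 1) (Q_poly b a r r * P n) + B_poly b a r * theta U (P n)"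
  proof (induction n rule: induct_nat_012)
    case 0
    then show ?case by (simp add: y_def P0 AQ)
  next
    case 1
    have "y 1 = [:- b 0, 1:] * Q_poly b a r r + B_poly b a r"
      using y_step[of 0] by (simp add: y_def AQ B_poly_def)
    then show ?case
      using \<open>theta U (P 1) = [:U 1:]\<close> by (simp add: P1 smult_add_right mult.commute)
  next
    case (ge2 n)
    define l where "l = [:- b (int n + 1), 1:]"
    define e where "e = (a (int n + 1))\<^sup>2"
    have P2: "P (n + 2) = l * P (n + 1) - smult e (P n)"
      unfolding l_def e_def by (rule P_step)
    have "U (P (n + 1)) = 0" by (rule orth) simp
    then have \<theta>2: "theta U (P (n + 2)) = l * theta U (P (n + 1)) - smult e (theta U (P n))"
      unfolding P2 by (simp only: l_def theta_linear[OF U] \<theta>_mult) simp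
    have "y (n + 2) = l * y (n + 1) - smult e (y n)"
      using y_step[of "n + 1"] by (simp add: y_def l_def e_def add.commute)
    then have "smult (U 1) (y (n + 2)) = l * smult (U 1) (y (n + 1)) - smult e (smult (U 1) (y n))"
      by (simp add: smult_diff_right mult.commute)
    also have "\<dots> = smult (U 1) (Q_poly b a r r * P (n + 2)) + B_poly b a r * theta U (P (n + 2))"
      using ge2 unfolding \<theta>2 unfolding P2
      by (simp add: smult_add_right smult_diff_right algebra_simps)
    finally have "smult (U 1) (y (n + 2)) =
        smult (U 1) (Q_poly b a r r * P (n + 2)) + B_poly b a r * theta U (P (n + 2))" .
    then show ?case by simp
  qed
  then show ?thesis by (simp add: y_def)
qed

section \<open>The differential equation\<close>

lemma R\<^sub>2_linear:
  "R\<^sub>2 \<sigma> \<tau> B n (p + q) = R\<^sub>2 \<sigma> \<tau> B n p + R\<^sub>2 \<sigma> \<tau> B n q"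
  "R\<^sub>2 \<sigma> \<tau> B n (smult c p) = smult c (R\<^sub>2 \<sigma> \<tau> B n p)"
  by (simp_all add: R\<^sub>2_def pderiv_add pderiv_smult smult_add_right algebra_simps)

text \<open>
  That is \<open>R\<^sub>2 B = B\<^sup>3 (A\<^sup>* + \<lambda>\<^sub>n)\<close>: the lower order coefficients of \<open>R\<^sub>2\<close> are exactly those that
  cancel the derivatives of \<open>B\<close> in \<open>(Bv)'\<close> and \<open>(Bv)''\<close>.
\<close>

lemma R\<^sub>2_mult_B:
  "R\<^sub>2 \<sigma> \<tau> B n (B * v) =
    B ^ 3 * (\<sigma> * pderiv (pderiv v) + (2 * pderiv \<sigma> - \<tau>) * pderiv v
      + (pderiv (pderiv \<sigma>) - pderiv \<tau>) * v + eigenval \<sigma> \<tau> n * v)"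
proof -
  have const: "smult (((of_nat n)\<^sup>2 - of_nat n - 2) / 2) (pderiv (pderiv \<sigma>))
        + smult (1 + of_nat n) (pderiv \<tau>) =
      - (pderiv (pderiv \<sigma>) - pderiv \<tau> + eigenval \<sigma> \<tau> n)"
    by (simp add: poly_eq_iff eigenval_def field_simps power2_eq_square)
  show ?thesis
    unfolding R\<^sub>2_def \<rho>\<^sub>1_def \<rho>\<^sub>0_def const
    by (simp add: pderiv_mult pderiv_add power2_eq_square power3_eq_cube algebra_simps)
qed

lemma R\<^sub>2_mult_eigenfunction:
  assumes "\<sigma> * pderiv (pderiv p) + \<tau> * pderiv p + eigenval \<sigma> \<tau> n * p = 0"
  shows "R\<^sub>2 \<sigma> \<tau> B n (Q * p) + (pderiv (pderiv \<sigma>) - 2 * pderiv \<tau>) * B ^ 3 * pderiv p =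
    M_poly \<sigma> \<tau> B Q n 0 * p + N_poly \<sigma> \<tau> B Q n 0 * pderiv p"
proof -
  have "R\<^sub>2 \<sigma> \<tau> B n (Q * p) + (pderiv (pderiv \<sigma>) - 2 * pderiv \<tau>) * B ^ 3 * pderiv p =
    M_poly \<sigma> \<tau> B Q n 0 * p + N_poly \<sigma> \<tau> B Q n 0 * pderiv p
    + B\<^sup>2 * Q * (\<sigma> * pderiv (pderiv p) + \<tau> * pderiv p + eigenval \<sigma> \<tau> n * p)"
    by (simp add: R\<^sub>2_def pderiv_mult pderiv_add algebra_simps)
  then show ?thesis by (simp add: assms)
qed

lemma M_N_poly_Suc:
  assumes "\<sigma> * pderiv (pderiv p) + \<tau> * pderiv p + eigenval \<sigma> \<tau> n * p = 0"
  shows "\<sigma> * pderiv (M_poly \<sigma> \<tau> B Q n i * p + N_poly \<sigma> \<tau> B Q n i * pderiv p) =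
    M_poly \<sigma> \<tau> B Q n (Suc i) * p + N_poly \<sigma> \<tau> B Q n (Suc i) * pderiv p"
proof -
  have "\<sigma> * pderiv (M_poly \<sigma> \<tau> B Q n i * p + N_poly \<sigma> \<tau> B Q n i * pderiv p) =
    M_poly \<sigma> \<tau> B Q n (Suc i) * p + N_poly \<sigma> \<tau> B Q n (Suc i) * pderiv p
    + N_poly \<sigma> \<tau> B Q n i * (\<sigma> * pderiv (pderiv p) + \<tau> * pderiv p + eigenval \<sigma> \<tau> n * p)"
    by (simp add: pderiv_mult pderiv_add algebra_simps)
  then show ?thesis by (simp add: assms)
qed

text \<open>
  The factor \<open>u = U 1\<close> introduced by \<open>\<theta>\<close> occurs in all terms and is nonzero because
  \<open>U (P\<^sub>0P\<^sub>0) \<noteq> 0\<close>, so it can be cancelled at the end.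
\<close>

lemma R\<^sub>2_anti_associated:
  assumes cl: "classical_OPS \<sigma> \<tau> P" and rec: "recurrence_coeffs b a P" and "r \<ge> 1"
  defines "B \<equiv> B_poly b a r" and "Q \<equiv> Q_poly b a r r"
  shows "R\<^sub>2 \<sigma> \<tau> B n (anti_associated b a r (n + r)) =
    M_poly \<sigma> \<tau> B Q n 0 * P n + N_poly \<sigma> \<tau> B Q n 0 * pderiv (P n)"
proof -
  have deg: "degree \<sigma> \<le> 2" "degree \<tau> \<le> 1" "degree \<tau> = 1"
    and ode: "\<sigma> * pderiv (pderiv (P n)) + \<tau> * pderiv (P n) + eigenval \<sigma> \<tau> n * P n = 0"
    using cl by (auto simp: classical_OPS_def)
  obtain U where "\<forall>p q. U (p + q) = U p + U q" "\<forall>c p. U (smult c p) = c * U p"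
    and orth: "\<And>m n. U (P m * P n) = 0 \<longleftrightarrow> m \<noteq> n"
    using cl unfolding classical_OPS_def monic_OPS_def by blast
  then have U: "linear_functional U" by (simp add: linear_functional_def)
  have P0: "P 0 = 1" using rec by (simp add: recurrence_coeffs_def)
  have U1: "U 1 \<noteq> 0" using orth[of 0 0] by (simp add: P0)
  have UP: "U (P m) = 0" if "m > 0" for m using orth[of 0 m] that by (simp add: P0)
  obtain l where l: "eigenval \<sigma> \<tau> n = [:l:]" using eigenval_eq_const deg by blast
  have "\<sigma> * pderiv (pderiv (P n)) + \<tau> * pderiv (P n) = smult (- l) (P n)"
    using ode by (simp add: l eq_neg_iff_add_eq_0)
  then have "\<sigma> * pderiv (pderiv (theta U (P n))) + (2 * pderiv \<sigma> - \<tau>) * pderiv (theta U (P n))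
      + (pderiv (pderiv \<sigma>) - pderiv \<tau>) * theta U (P n) + eigenval \<sigma> \<tau> n * theta U (P n) =
      smult (U 1) ((pderiv (pderiv \<sigma>) - 2 * pderiv \<tau>) * pderiv (P n))"
    using theta_intertwines_adjoint[OF U deg(1,2) classical_functional_Pearson[OF cl U UP], of "P n"]
    by (simp add: theta_linear[OF U] l)
  then have "R\<^sub>2 \<sigma> \<tau> B n (B * theta U (P n)) =
      smult (U 1) ((pderiv (pderiv \<sigma>) - 2 * pderiv \<tau>) * B ^ 3 * pderiv (P n))"
    by (simp add: R\<^sub>2_mult_B mult_ac)
  moreover have "R\<^sub>2 \<sigma> \<tau> B n (smult (U 1) (anti_associated b a r (n + r))) =
      R\<^sub>2 \<sigma> \<tau> B n (smult (U 1) (Q * P n) + B * theta U (P n))"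
    using anti_associated_decomposition[OF rec U UP \<open>r \<ge> 1\<close>] by (simp add: B_def Q_def)
  ultimately have "smult (U 1) (R\<^sub>2 \<sigma> \<tau> B n (anti_associated b a r (n + r))) =
      smult (U 1) (R\<^sub>2 \<sigma> \<tau> B n (Q * P n)
        + (pderiv (pderiv \<sigma>) - 2 * pderiv \<tau>) * B ^ 3 * pderiv (P n))"
    by (simp only: R\<^sub>2_linear smult_add_right)
  then show ?thesis
    using U1 by (simp only: R\<^sub>2_mult_eigenfunction[OF ode] smult_cancel)
qed

theorem mainTheorem3:
  fixes \<sigma> \<tau> :: "complex poly" and P :: "nat \<Rightarrow> complex poly"
    and b a :: "int \<Rightarrow> complex" and r n :: nat
  assumes "classical_OPS \<sigma> \<tau> P"
    and "recurrence_coeffs b a P"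
    and "r \<ge> 1"
    and "(a 0)\<^sup>2 \<noteq> 0"
  defines "B \<equiv> B_poly b a r" and "Q \<equiv> Q_poly b a r r"
    and "y \<equiv> anti_associated b a r (n + r)"
  defines "R \<equiv> R\<^sub>2 \<sigma> \<tau> B n" and "M \<equiv> M_poly \<sigma> \<tau> B Q n" and "N \<equiv> N_poly \<sigma> \<tau> B Q n"
  shows "det (vector
           [vector [R y, M 0, N 0],
            vector [\<sigma> * pderiv (R y), M 1, N 1],
            vector [\<sigma> * pderiv (\<sigma> * pderiv (R y)), M 2, N 2]] :: complex poly ^ 3 ^ 3) = 0"
proof -
  have ode: "\<sigma> * pderiv (pderiv (P n)) + \<tau> * pderiv (P n) + eigenval \<sigma> \<tau> n * P n = 0"
    using assms(1) by (simp add: classical_OPS_def)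
  have R0: "R y = M 0 * P n + N 0 * pderiv (P n)"
    unfolding R_def M_def N_def y_def B_def Q_def
    by (rule R\<^sub>2_anti_associated[OF assms(1-3)])
  have R1: "\<sigma> * pderiv (R y) = M 1 * P n + N 1 * pderiv (P n)"
    unfolding R0 M_def N_def One_nat_def by (rule M_N_poly_Suc[OF ode])
  have R2: "\<sigma> * pderiv (\<sigma> * pderiv (R y)) = M 2 * P n + N 2 * pderiv (P n)"
    unfolding R1 unfolding M_def N_def numeral_2_eq_2 One_nat_def by (rule M_N_poly_Suc[OF ode])
  show ?thesis
    unfolding R2 unfolding R1 unfolding R0 by (simp add: det_3 algebra_simps)
qed

end
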